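(* Let $\mathcal{H}$ and $\mathcal{G}$ be real Hilbert spaces (norms denoted $\|\cdot\|$), let $L\colon\mathcal{H}\to\mathcal{G}$ be linear and bounded, let $z\in\mathcal{G}$, let $\gamma\in\,]0,+\infty[$, and set $f\colon\mathcal{H}\to\mathbb{R}\colon x\mapsto\gamma\|Lx-z\|^2/2$. Then $f\in\Gamma_0(\mathcal{H})$ and $$(\forall x\in\mathcal{H})\quad\operatorname{prox}_f x=(\operatorname{Id}+\gamma L^*L)^{-1}(x+\gamma L^*z).$$
   Context: $\Gamma_0(\mathcal{H})$ is the class of lower semicontinuous convex functions from $\mathcal{H}$ to $]-\infty,+\infty]$ that are proper (nonempty domain). For $f\in\Gamma_0(\mathcal{H})$, the proximity operator $\operatorname{prox}_f\colon\mathcal{H}\to\mathcal{H}$ maps $x$ to the unique minimizer over $y\in\mathcal{H}$ of $f(y)+\frac12\|x-y\|^2$. $L^*$ is the adjoint of $L$. *)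

theory Defs
  imports "HOL-Analysis.Analysis"
begin

text \<open>A real Hilbert space is a type of sort \<open>{real_inner, complete_space}\<close>. Functions with values
  in $]-\infty,+\infty]$ are \<open>ereal\<close>-valued functions that avoid \<open>-\<infinity>\<close>.\<close>

definition lower_semicontinuous :: "('a::topological_space \<Rightarrow> ereal) \<Rightarrow> bool" where
  "lower_semicontinuous f \<longleftrightarrow> (\<forall>x. \<forall>c < f x. \<forall>\<^sub>F y in nhds x. c < f y)"

text \<open>The library's \<^const>\<open>convex_on\<close> is restricted to real-valued functions. The endpoints
  $t = 0$ and $t = 1$ are trivial and left out; for $0 < t < 1$ and values different from
  \<open>-\<infinity>\<close>, the right-hand side below is the usual extended real arithmetic.\<close>

definition ereal_convex :: "('a::real_vector \<Rightarrow> ereal) \<Rightarrow> bool" where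
  "ereal_convex f \<longleftrightarrow> (\<forall>x y. \<forall>t::real. 0 < t \<and> t < 1 \<longrightarrow>
     f (t *\<^sub>R x + (1 - t) *\<^sub>R y) \<le> ereal t * f x + ereal (1 - t) * f y)"

definition Gamma0 :: "('a::{real_inner, complete_space} \<Rightarrow> ereal) set" where
  "Gamma0 = {f. (\<forall>x. f x \<noteq> -\<infinity>) \<and> (\<exists>x. f x \<noteq> \<infinity>) \<and>
     ereal_convex f \<and> lower_semicontinuous f}"

text \<open>Meaningful for \<^term>\<open>f \<in> Gamma0\<close>, where the minimizer exists and is unique.\<close>

definition prox :: "('a::{real_inner, complete_space} \<Rightarrow> ereal) \<Rightarrow> 'a \<Rightarrow> 'a" where
  "prox f x = (THE p. \<forall>y. f p + ereal ((norm (x - p))\<^sup>2 / 2) \<le> f y + ereal ((norm (x - y))\<^sup>2 / 2))"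

end

theory Submission
  imports Defs
begin

text \<open>Write \<open>B u v = u \<bullet> v + \<gamma> * (L u \<bullet> L v)\<close>. This form is symmetric, bounded and coercive, and
  \<open>B u v = (u + \<gamma> L\<^sup>* L u) \<bullet> v\<close>. The proof rests on one existence result, the symmetric case of
  the Lax--Milgram theorem (\<open>energy_form_representation\<close>): every bounded linear functional is
  \<open>B u\<close> for some \<open>u\<close>. It is used twice. For \<open>\<gamma> = 0\<close> it is the Riesz representation theorem, which
  shows that the adjoint, a mere choice by definition, satisfies its defining identity on Hilbert
  spaces. For the given \<open>\<gamma>\<close> it shows that \<open>Id + \<gamma> L\<^sup>* L\<close> is onto; coercivity makes it injective.

  The objective \<open>y \<mapsto> \<gamma> \<parallel>L y - z\<parallel>\<^sup>2 / 2 + \<parallel>x - y\<parallel>\<^sup>2 / 2\<close> is quadratic, with second-order part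
  \<open>B v v / 2\<close>. Its derivative at \<open>p\<close> vanishes exactly when \<open>p + \<gamma> L\<^sup>* L p = x + \<gamma> L\<^sup>* z\<close>, and then
  its value at \<open>y\<close> exceeds that at \<open>p\<close> by \<open>B (y - p) (y - p) / 2 \<ge> \<parallel>y - p\<parallel>\<^sup>2 / 2\<close>. So \<open>p\<close> is the
  unique minimizer.\<close>

section \<open>Representation of functionals by the energy form\<close>

text \<open>A quadratic that never drops below its value at zero has no linear term; this turns
  minimality along every line into a variational equation.\<close>

lemma linear_coefficient_zero_if_quadratic_nonneg:
  fixes a b :: real
  assumes nonneg: "\<And>t. 0 \<le> 2 * t * b + t\<^sup>2 * a"
  shows "b = 0"
proof (rule ccontr)
  assume "b \<noteq> 0"
  define c where "c = \<bar>a\<bar> + 1"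
  have c: "c > 0" "a \<le> c" by (auto simp: c_def)
  \<comment> \<open>At \<open>t = - b / c\<close> the quadratic is at most \<open>- b\<^sup>2 / c\<close>, because \<open>a \<le> c\<close>.\<close>
  have "0 \<le> 2 * (- b / c) * b + (- b / c)\<^sup>2 * a" by (rule nonneg)
  also have "\<dots> \<le> 2 * (- b / c) * b + (- b / c)\<^sup>2 * c"
    using c by (intro add_left_mono mult_left_mono) auto
  also have "\<dots> = - (b\<^sup>2 / c)"
    using c by (simp add: power2_eq_square field_simps)
  also have "\<dots> < 0" using c \<open>b \<noteq> 0\<close> by simp
  finally show False by simp
qed

text \<open>The representing vector minimizes the energy \<open>J u = B u u - 2 * \<phi> u\<close>. The functional \<open>J\<close> is
  bounded below since \<open>\<phi>\<close> is bounded, and the parallelogram law makes minimizing sequences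
  Cauchy: if the energies of \<open>a\<close> and \<open>b\<close> are close to the infimum, the energy of their midpoint,
  which lies above the infimum, falls short of the average by \<open>B d d\<close> with \<open>d = (a - b) / 2\<close>.
  The limit is a minimizer since \<open>J\<close> is continuous, and its variational equation is the claim.\<close>

lemma energy_form_representation:
  fixes L :: "'h::{real_inner, complete_space} \<Rightarrow> 'g::real_inner"
    and \<phi> :: "'h \<Rightarrow> real"
  assumes L: "bounded_linear L" and \<phi>: "bounded_linear \<phi>" and \<gamma>: "0 \<le> \<gamma>"
  shows "\<exists>u. \<forall>v. u \<bullet> v + \<gamma> * (L u \<bullet> L v) = \<phi> v"
proof -
  interpret L: bounded_linear L by (rule L)
  interpret \<phi>: bounded_linear \<phi> by (rule \<phi>)
  define N where "N v = v \<bullet> v + \<gamma> * (L v \<bullet> L v)" for v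
  define J where "J u = N u - 2 * \<phi> u" for u
  have J_line: "J (u + t *\<^sub>R v) = J u + 2 * t * (u \<bullet> v + \<gamma> * (L u \<bullet> L v) - \<phi> v) + t\<^sup>2 * N v"
    for u v t
    by (simp add: J_def N_def L.add L.scaleR \<phi>.add \<phi>.scaleR inner_add_left inner_add_right
        inner_commute[of v u] inner_commute[of "L v" "L u"] power2_eq_square algebra_simps)
  have norm_le_N: "(norm v)\<^sup>2 \<le> N v" for v
    using \<gamma> by (simp add: N_def power2_norm_eq_inner)
  obtain K where K: "\<And>v. norm (\<phi> v) \<le> norm v * K"
    using \<phi>.bounded by blast
  have bounded_below: "- K\<^sup>2 \<le> J u" for u
  proof -
    have "\<phi> u \<le> norm u * K" using K[of u] by simp
    moreover have "0 \<le> (norm u - K)\<^sup>2" by simp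
    ultimately show ?thesis using norm_le_N[of u]
      by (simp add: J_def power2_eq_square algebra_simps)
  qed
  define I where "I = (INF u. J u)"
  have bdd: "bdd_below (range J)" by (rule bdd_belowI2[OF bounded_below])
  have I_le: "I \<le> J u" for u unfolding I_def by (rule cINF_lower[OF bdd]) simp
  have "\<exists>u. J u < I + 1 / real (Suc n)" for n
    using cINF_less_iff[OF _ bdd, of "I + 1 / real (Suc n)"] by (auto simp: I_def)
  then obtain s where s: "\<And>n. J (s n) < I + 1 / real (Suc n)" by metis
  have gap: "(norm (a - b))\<^sup>2 \<le> 2 * ((J a - I) + (J b - I))" for a b
  proof -
    define m d where "m = (1/2) *\<^sub>R (a + b)" and "d = (1/2) *\<^sub>R (a - b)"
    have "m + 1 *\<^sub>R d = (1/2 + 1/2) *\<^sub>R a" "m + (-1) *\<^sub>R d = (1/2 + 1/2) *\<^sub>R b"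
      unfolding m_def d_def by (simp_all only: scaleR_add_left) (simp_all add: algebra_simps)
    then have "J a + J b = 2 * J m + 2 * N d"
      using J_line[of m 1 d] J_line[of m "-1" d] by simp
    moreover have "(norm d)\<^sup>2 = (norm (a - b))\<^sup>2 / 4"
      by (simp add: d_def power2_eq_square)
    ultimately show ?thesis using norm_le_N[of d] I_le[of m] by argo
  qed
  have "Cauchy s"
  proof (rule metric_CauchyI)
    fix e :: real assume e: "0 < e"
    then obtain M where M: "1 / real (Suc M) < e\<^sup>2 / 4"
      using nat_approx_posE[of "e\<^sup>2 / 4"] by auto
    have close: "J (s n) - I < e\<^sup>2 / 4" if "M \<le> n" for n
    proof -
      have "1 / real (Suc n) \<le> 1 / real (Suc M)" using that by (simp add: frac_le)
      then show ?thesis using s[of n] M by linarith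
    qed
    have "dist (s m) (s n) < e" if "M \<le> m" "M \<le> n" for m n
    proof -
      have "(norm (s m - s n))\<^sup>2 < e\<^sup>2"
        using gap[of "s m" "s n"] close[OF that(1)] close[OF that(2)] by argo
      then show ?thesis using e by (simp add: dist_norm power2_less_imp_less)
    qed
    then show "\<exists>M. \<forall>m\<ge>M. \<forall>n\<ge>M. dist (s m) (s n) < e" by blast
  qed
  then obtain u where u: "s \<longlonglongrightarrow> u" by (auto simp: Cauchy_convergent_iff convergent_def)
  have "(\<lambda>n. J (s n)) \<longlonglongrightarrow> J u"
    unfolding J_def N_def by (intro tendsto_intros L.tendsto \<phi>.tendsto u)
  moreover have "(\<lambda>n. I + 1 / real (Suc n)) \<longlonglongrightarrow> I + 0"
    by (intro tendsto_add tendsto_const LIMSEQ_Suc[OF lim_1_over_n])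
  ultimately have "J u \<le> I + 0"
    by (rule LIMSEQ_le) (use s less_imp_le in blast)
  then have minimal: "J u \<le> J w" for w using I_le[of w] by simp
  have "u \<bullet> v + \<gamma> * (L u \<bullet> L v) - \<phi> v = 0" for v
  proof (rule linear_coefficient_zero_if_quadratic_nonneg)
    show "0 \<le> 2 * t * (u \<bullet> v + \<gamma> * (L u \<bullet> L v) - \<phi> v) + t\<^sup>2 * N v" for t
      using minimal[of "u + t *\<^sub>R v"] J_line[of u t v] by linarith
  qed
  then show ?thesis by auto
qed

section \<open>The adjoint and the operator \<open>Id + \<gamma> L\<^sup>* L\<close>\<close>

text \<open>The image of \<open>y\<close> under the adjoint is the Riesz vector of the functional \<open>x \<mapsto> L x \<bullet> y\<close>.\<close>

lemma inner_adjoint_Hilbert: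
  fixes L :: "'h::{real_inner, complete_space} \<Rightarrow> 'g::real_inner"
  assumes L: "bounded_linear L"
  shows "x \<bullet> adjoint L y = L x \<bullet> y"
proof -
  have "\<exists>u. \<forall>v. v \<bullet> u = L v \<bullet> y" for y
  proof -
    have "bounded_linear (\<lambda>v. L v \<bullet> y)"
      by (rule bounded_linear_compose[OF bounded_linear_inner_left L])
    \<comment> \<open>Riesz representation: the energy form with \<open>\<gamma> = 0\<close> is the inner product itself.\<close>
    from energy_form_representation[OF L this, of 0] show ?thesis
      by (auto simp: inner_commute)
  qed
  then have "\<exists>L'. \<forall>x y. L x \<bullet> y = x \<bullet> L' y" by metis
  then have "\<forall>x y. L x \<bullet> y = x \<bullet> adjoint L y"
    unfolding adjoint_def by (rule someI_ex)
  then show ?thesis by simp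
qed

lemma inner_id_plus_adjoint:
  fixes L :: "'h::{real_inner, complete_space} \<Rightarrow> 'g::real_inner"
  assumes L: "bounded_linear L"
  shows "(u + \<gamma> *\<^sub>R adjoint L (L u)) \<bullet> v = u \<bullet> v + \<gamma> * (L u \<bullet> L v)"
  by (simp add: inner_add_left inner_commute[of "adjoint L (L u)" v]
      inner_adjoint_Hilbert[OF L] inner_commute[of "L v" "L u"])

text \<open>Surjectivity represents the functional \<open>w \<bullet> _\<close> by the energy form. For injectivity, the
  difference \<open>d\<close> of two points with equal image satisfies \<open>0 = B d d \<ge> d \<bullet> d\<close>.\<close>

lemma bij_id_plus_adjoint:
  fixes L :: "'h::{real_inner, complete_space} \<Rightarrow> 'g::real_inner"
  assumes L: "bounded_linear L" and \<gamma>: "0 \<le> \<gamma>"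
  shows "bij (\<lambda>u. u + \<gamma> *\<^sub>R adjoint L (L u))" (is "bij ?T")
proof (rule bijI)
  interpret L: bounded_linear L by (rule L)
  show "inj ?T"
  proof (rule injI)
    fix a b assume eq: "?T a = ?T b"
    define d where "d = a - b"
    have "?T a \<bullet> d - ?T b \<bullet> d = 0" using eq by simp
    then have "d \<bullet> d + \<gamma> * (L d \<bullet> L d) = 0"
      unfolding inner_id_plus_adjoint[OF L]
      by (simp add: d_def L.diff inner_diff_left algebra_simps)
    moreover have "0 \<le> \<gamma> * (L d \<bullet> L d)" using \<gamma> by simp
    ultimately have "d \<bullet> d = 0" using inner_ge_zero[of d] by linarith
    then show "a = b" by (simp add: d_def)
  qed
  show "surj ?T"
  proof (unfold surj_def, rule allI)
    fix w
    obtain u where "\<And>v. u \<bullet> v + \<gamma> * (L u \<bullet> L v) = w \<bullet> v"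
      using energy_form_representation[OF L bounded_linear_inner_right \<gamma>] by blast
    then have "?T u \<bullet> v = w \<bullet> v" for v
      by (simp only: inner_id_plus_adjoint[OF L])
    then have "w = ?T u" using vector_eq_rdot by metis
    then show "\<exists>u. w = ?T u" ..
  qed
qed

section \<open>The least-squares function and its proximity operator\<close>

lemma ereal_in_Gamma0:
  fixes f :: "'a::{real_inner, complete_space} \<Rightarrow> real"
  assumes "convex_on UNIV f" and "continuous_on UNIV f"
  shows "(\<lambda>x. ereal (f x)) \<in> Gamma0"
proof -
  have "ereal_convex (\<lambda>x. ereal (f x))"
    unfolding ereal_convex_def
  proof (intro allI impI)
    fix x y :: 'a and t :: real assume "0 < t \<and> t < 1"
    then show "ereal (f (t *\<^sub>R x + (1 - t) *\<^sub>R y)) \<le> ereal t * ereal (f x) + ereal (1 - t) * ereal (f y)"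
      using convex_onD[OF assms(1), of "1 - t" x y] by simp
  qed
  moreover have "lower_semicontinuous (\<lambda>x. ereal (f x))"
    unfolding lower_semicontinuous_def
  proof (intro allI impI)
    fix x and c :: ereal assume c: "c < ereal (f x)"
    have "isCont f x" using assms(2) by (simp add: continuous_on_eq_continuous_at)
    then have "filterlim f (nhds (f x)) (nhds x)" by (simp add: continuous_at tendsto_at_iff_tendsto_nhds)
    then have "((\<lambda>y. ereal (f y)) \<longlongrightarrow> ereal (f x)) (nhds x)" by (rule tendsto_ereal)
    then show "\<forall>\<^sub>F y in nhds x. c < ereal (f y)" using c by (rule order_tendstoD)
  qed
  ultimately show ?thesis by (simp add: Gamma0_def)
qed

lemma prox_eqI:
  assumes "\<And>y. y \<noteq> p \<Longrightarrow> f p + (norm (x - p))\<^sup>2 / 2 < f y + (norm (x - y))\<^sup>2 / 2"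
  shows "prox (\<lambda>x. ereal (f x)) x = p"
  unfolding prox_def
proof (rule the_equality)
  show "\<forall>y. ereal (f p) + ereal ((norm (x - p))\<^sup>2 / 2) \<le> ereal (f y) + ereal ((norm (x - y))\<^sup>2 / 2)"
  proof
    show "ereal (f p) + ereal ((norm (x - p))\<^sup>2 / 2) \<le> ereal (f y) + ereal ((norm (x - y))\<^sup>2 / 2)"
      for y
      using assms[of y] by (cases "y = p") auto
  qed
next
  fix q assume "\<forall>y. ereal (f q) + ereal ((norm (x - q))\<^sup>2 / 2) \<le> ereal (f y) + ereal ((norm (x - y))\<^sup>2 / 2)"
  then have "f q + (norm (x - q))\<^sup>2 / 2 \<le> f p + (norm (x - p))\<^sup>2 / 2" by simp
  then show "q = p" using assms[of q] by force
qed

text \<open>The map \<open>x \<mapsto> \<parallel>L x - z\<parallel>\<close> is convex, being the norm of an affine map; squaring preserves this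
  because the square is convex and increasing on the nonnegative reals.\<close>

lemma least_squares_in_Gamma0:
  fixes L :: "'h::{real_inner, complete_space} \<Rightarrow> 'g::real_inner"
  assumes L: "bounded_linear L" and \<gamma>: "0 \<le> \<gamma>"
  shows "(\<lambda>x. ereal (\<gamma> * (norm (L x - z))\<^sup>2 / 2)) \<in> Gamma0"
proof (rule ereal_in_Gamma0)
  interpret L: bounded_linear L by (rule L)
  show "continuous_on UNIV (\<lambda>x. \<gamma> * (norm (L x - z))\<^sup>2 / 2)"
    by (intro continuous_intros L.continuous_on) auto
  have "convex_on UNIV (\<lambda>x. (norm (L x - z))\<^sup>2)"
  proof (rule convex_onI)
    fix t :: real and x y assume t: "0 < t" "t < 1"
    have "L ((1 - t) *\<^sub>R x + t *\<^sub>R y) - z = (1 - t) *\<^sub>R (L x - z) + t *\<^sub>R (L y - z)"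
      by (simp add: L.add L.diff L.scaleR scaleR_diff_right scaleR_diff_left)
    also have "norm \<dots> \<le> (1 - t) * norm (L x - z) + t * norm (L y - z)"
      using t by (intro norm_triangle_le) simp
    finally have "(norm (L ((1 - t) *\<^sub>R x + t *\<^sub>R y) - z))\<^sup>2
        \<le> ((1 - t) * norm (L x - z) + t * norm (L y - z))\<^sup>2"
      by (rule power_mono) simp
    also have "\<dots> \<le> (1 - t) * (norm (L x - z))\<^sup>2 + t * (norm (L y - z))\<^sup>2"
      using convex_onD[OF convex_power2, of t "norm (L x - z)" "norm (L y - z)"] t by simp
    finally show "(norm (L ((1 - t) *\<^sub>R x + t *\<^sub>R y) - z))\<^sup>2
        \<le> (1 - t) * (norm (L x - z))\<^sup>2 + t * (norm (L y - z))\<^sup>2" .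
  qed simp
  then have "convex_on UNIV (\<lambda>x. (\<gamma> / 2) * (norm (L x - z))\<^sup>2)"
    using \<gamma> by (intro convex_on_cmul) auto
  then show "convex_on UNIV (\<lambda>x. \<gamma> * (norm (L x - z))\<^sup>2 / 2)" by simp
qed

text \<open>The normal equation cancels the first-order term in the expansion of the objective around
  \<open>p\<close>; only the nonnegative second-order part remains.\<close>

lemma prox_least_squares_eqI:
  fixes L :: "'h::{real_inner, complete_space} \<Rightarrow> 'g::real_inner"
  assumes L: "bounded_linear L" and \<gamma>: "0 \<le> \<gamma>"
    and normal_eq: "p + \<gamma> *\<^sub>R adjoint L (L p) = x + \<gamma> *\<^sub>R adjoint L z"
  shows "prox (\<lambda>x. ereal (\<gamma> * (norm (L x - z))\<^sup>2 / 2)) x = p"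
proof (rule prox_eqI)
  interpret L: bounded_linear L by (rule L)
  fix y assume "y \<noteq> p"
  define v where "v = y - p"
  have y: "y = p + v" and v: "0 < (norm v)\<^sup>2" using \<open>y \<noteq> p\<close> by (auto simp: v_def)
  have "(p + \<gamma> *\<^sub>R adjoint L (L p)) \<bullet> v = (x + \<gamma> *\<^sub>R adjoint L z) \<bullet> v"
    by (simp only: normal_eq)
  then have "p \<bullet> v + \<gamma> * (L p \<bullet> L v) = x \<bullet> v + \<gamma> * (z \<bullet> L v)"
    unfolding inner_id_plus_adjoint[OF L]
    by (simp add: inner_add_left inner_commute[of "adjoint L z" v]
        inner_adjoint_Hilbert[OF L] inner_commute[of "L v" z])
  then have stationary: "\<gamma> * ((L p - z) \<bullet> L v) - (x - p) \<bullet> v = 0"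
    by (simp add: inner_diff_left algebra_simps)
  have "(norm (L y - z))\<^sup>2 = (norm (L p - z))\<^sup>2 + 2 * ((L p - z) \<bullet> L v) + (norm (L v))\<^sup>2"
    unfolding y L.add power2_norm_eq_inner
    by (simp add: inner_add_left inner_add_right inner_diff_left inner_diff_right inner_commute)
  moreover have "(norm (x - y))\<^sup>2 = (norm (x - p))\<^sup>2 - 2 * ((x - p) \<bullet> v) + (norm v)\<^sup>2"
    unfolding y power2_norm_eq_inner
    by (simp add: inner_add_left inner_add_right inner_diff_left inner_diff_right inner_commute)
  ultimately have "\<gamma> * (norm (L y - z))\<^sup>2 / 2 + (norm (x - y))\<^sup>2 / 2
      = \<gamma> * (norm (L p - z))\<^sup>2 / 2 + (norm (x - p))\<^sup>2 / 2
        + (\<gamma> * ((L p - z) \<bullet> L v) - (x - p) \<bullet> v)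
        + (\<gamma> * (norm (L v))\<^sup>2 + (norm v)\<^sup>2) / 2"
    by (simp add: field_simps)
  moreover have "0 < (\<gamma> * (norm (L v))\<^sup>2 + (norm v)\<^sup>2) / 2"
    using \<gamma> v by (simp add: add_nonneg_pos)
  ultimately show "\<gamma> * (norm (L p - z))\<^sup>2 / 2 + (norm (x - p))\<^sup>2 / 2
      < \<gamma> * (norm (L y - z))\<^sup>2 / 2 + (norm (x - y))\<^sup>2 / 2"
    unfolding stationary by linarith
qed

theorem proposition2p6:
  fixes L :: "'h::{real_inner, complete_space} \<Rightarrow> 'g::{real_inner, complete_space}"
    and z :: 'g
    and \<gamma> :: real
    and f :: "'h \<Rightarrow> real"
  assumes L: "bounded_linear L"
    and \<gamma>: "0 < \<gamma>"
    and f: "f = (\<lambda>x. \<gamma> * (norm (L x - z))\<^sup>2 / 2)"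
  shows "(\<lambda>x. ereal (f x)) \<in> Gamma0
    \<and> bij (\<lambda>u. u + \<gamma> *\<^sub>R adjoint L (L u))
    \<and> (\<forall>x. prox (\<lambda>x. ereal (f x)) x =
          inv (\<lambda>u. u + \<gamma> *\<^sub>R adjoint L (L u)) (x + \<gamma> *\<^sub>R adjoint L z))"
proof (intro conjI allI)
  let ?T = "\<lambda>u. u + \<gamma> *\<^sub>R adjoint L (L u)"
  have \<gamma>': "0 \<le> \<gamma>" using \<gamma> by simp
  show "(\<lambda>x. ereal (f x)) \<in> Gamma0"
    unfolding f by (rule least_squares_in_Gamma0[OF L \<gamma>'])
  show bij: "bij ?T" by (rule bij_id_plus_adjoint[OF L \<gamma>'])
  fix x
  have "?T (inv ?T (x + \<gamma> *\<^sub>R adjoint L z)) = x + \<gamma> *\<^sub>R adjoint L z"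
    by (rule surj_f_inv_f[OF bij_is_surj[OF bij]])
  then show "prox (\<lambda>x. ereal (f x)) x = inv ?T (x + \<gamma> *\<^sub>R adjoint L z)"
    unfolding f by (rule prox_least_squares_eqI[OF L \<gamma>'])
qed

end
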